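(* Let $\mathcal{P}^+\subset\mathrm{Sym}^2(\mathbb{R}^n)$ be a closed convex cone (with vertex at the origin) satisfying the Positivity Condition, and let $X\subset\mathbb{R}^n$ be a connected open set. The following two conditions are equivalent: (1) for every $K\subset\subset X$ (compact), $\widehat K\subset\subset X$ (i.e. $\widehat K$ is relatively compact in $X$); (2) there exists a $C^\infty$ proper exhaustion function $u$ for $X$ which is strictly $\mathcal{P}^+$-plurisubharmonic.
   Context: $\mathrm{Sym}^2(\mathbb{R}^n)$ is the space of quadratic forms on $\mathbb{R}^n$ (real symmetric $n\times n$ matrices) with inner product $\langle A,B\rangle=\mathrm{tr}(AB)$, and $\mathcal{P}=\{A:A\ge0\}$. The polar of $\mathcal{P}^+$ is $\mathcal{P}_+=\{A:\langle A,B\rangle\ge0\ \forall B\in\mathcal{P}^+\}$. Positivity Condition: every $A\in\mathcal{P}_+$ is $\ge0$, equivalently $\mathcal{P}\subset\mathcal{P}^+$. A function $u\in C^\infty(X)$ is $\mathcal{P}^+$-plurisubharmonic if $\mathrm{Hess}_xu\in\mathcal{P}^+$ for all $x\in X$, and strictly $\mathcal{P}^+$-plurisubharmonic if $\mathrm{Hess}_xu\in\mathrm{Int}\,\mathcal{P}^+$ for all $x\in X$. $\mathrm{PSH}^\infty(X)$ is the set of $\mathcal{P}^+$-plurisubharmonic functions in $C^\infty(X)$. For compact $K\subset X$, the hull is $\widehat K=\{x\in X:u(x)\le\sup_Ku\ \text{for all }u\in\mathrm{PSH}^\infty(X)\}$. A proper exhaustion function is one for which all sublevel sets $\{u\le c\}$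 are compact. *)

theory Defs
  imports "HOL-Analysis.Analysis"
begin

definition sym_mats :: "(real^'n^'n) set" where
  "sym_mats = {A. transpose A = A}"

definition psd_mats :: "(real^'n^'n) set" where
  "psd_mats = {A \<in> sym_mats. \<forall>v. 0 \<le> v \<bullet> (A *v v)}"

definition polar_cone :: "(real^'n^'n) set \<Rightarrow> (real^'n^'n) set" where
  "polar_cone P = {A \<in> sym_mats. \<forall>B\<in>P. 0 \<le> trace (A ** B)}"

definition positivity_condition :: "(real^'n^'n) set \<Rightarrow> bool" where
  "positivity_condition P \<longleftrightarrow> polar_cone P \<subseteq> psd_mats"

definition partial_deriv :: "'n \<Rightarrow> (real^'n \<Rightarrow> real) \<Rightarrow> real^'n \<Rightarrow> real" where
  "partial_deriv i u x = frechet_derivative u (at x) (axis i 1)"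

definition hess :: "(real^'n \<Rightarrow> real) \<Rightarrow> real^'n \<Rightarrow> real^'n^'n" where
  "hess u x = (\<chi> i j. partial_deriv i (partial_deriv j u) x)"

(* Functions are total; only their values on the set X, which is meant to be open, matter. *)
primrec Ck_on :: "nat \<Rightarrow> (real^'n) set \<Rightarrow> (real^'n \<Rightarrow> real) \<Rightarrow> bool" where
  "Ck_on 0 X u \<longleftrightarrow> continuous_on X u"
| "Ck_on (Suc k) X u \<longleftrightarrow>
     (\<forall>x\<in>X. u differentiable (at x)) \<and> (\<forall>i. Ck_on k X (partial_deriv i u))"

definition Cinf :: "(real^'n) set \<Rightarrow> (real^'n \<Rightarrow> real) set" where
  "Cinf X = {u. \<forall>k. Ck_on k X u}"

definition PSH_inf :: "(real^'n^'n) set \<Rightarrow> (real^'n) set \<Rightarrow> (real^'n \<Rightarrow> real) set" where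
  "PSH_inf P X = {u \<in> Cinf X. \<forall>x\<in>X. hess u x \<in> P}"

(* The interior is taken in the space of symmetric matrices: the interior in the
   space of all matrices is empty as soon as the dimension is at least 2. *)
definition strictly_PSH :: "(real^'n^'n) set \<Rightarrow> (real^'n) set \<Rightarrow> (real^'n \<Rightarrow> real) \<Rightarrow> bool" where
  "strictly_PSH P X u \<longleftrightarrow>
     u \<in> Cinf X \<and> (\<forall>x\<in>X. hess u x \<in> (top_of_set sym_mats) interior_of P)"

(* The supremum is taken in ereal so that it is -\<infinity> for empty K (whose hull is then empty). *)
definition psh_hull :: "(real^'n^'n) set \<Rightarrow> (real^'n) set \<Rightarrow> (real^'n) set \<Rightarrow> (real^'n) set" where
  "psh_hull P X K =
     {x \<in> X. \<forall>u\<in>PSH_inf P X. ereal (u x) \<le> (SUP y\<in>K. ereal (u y))}"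

definition relatively_compact_in :: "'a::topological_space set \<Rightarrow> 'a set \<Rightarrow> bool" where
  "relatively_compact_in S X \<longleftrightarrow> compact (closure S) \<and> closure S \<subseteq> X"

definition proper_exhaustion :: "(real^'n) set \<Rightarrow> (real^'n \<Rightarrow> real) \<Rightarrow> bool" where
  "proper_exhaustion X u \<longleftrightarrow> (\<forall>c. compact {x \<in> X. u x \<le> c})"

end

theory Submission
  imports Defs
begin

text \<open>
  Suppose first that \<open>u\<close> is a plurisubharmonic proper exhaustion. The hull of a compact \<open>K\<close> lies
  in the sublevel set \<open>{u \<le> max u}\<close>, with the maximum taken over \<open>K\<close>, and that set is compact
  in \<open>X\<close> (\<open>hull_relatively_compact\<close>).

  Conversely, suppose that hulls of compact sets are relatively compact. Then \<open>X\<close> is exhausted by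
  compact sets \<open>K m\<close> such that the interior of \<open>K (m + 1)\<close> contains both \<open>K m\<close> and its hull
  (\<open>exhaustion_by_hulls\<close>). A point outside the hull of \<open>K m\<close> is separated from \<open>K m\<close> by a smooth
  plurisubharmonic \<open>w\<close> that is positive at the point and nonpositive on \<open>K m\<close>. Composing \<open>w\<close> with a
  smooth convex increasing function that vanishes exactly on \<open>{t. t \<le> 0}\<close> keeps it
  plurisubharmonic and makes it vanish on \<open>K m\<close>. Finitely many such functions, added and scaled,
  give a nonnegative plurisubharmonic \<open>v m\<close> that is zero on \<open>K m\<close> and at least \<open>m\<close> on
  \<open>K (m + 2)\<close> minus the interior of \<open>K (m + 1)\<close> (\<open>PSH_large_on_compact\<close>). The function
  \<open>u x = (x \<bullet> x) / 2 + (\<Sum>m. v m x)\<close> is locally a finite sum, hence smooth. It is proper because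
  every point outside \<open>K (M + 1)\<close> lies in one of these shells with \<open>m \<ge> M\<close>. It is strictly
  plurisubharmonic because its Hessian is the identity matrix plus an element of the cone.

  The Positivity Condition enters through two facts about the cone: it contains every rank-one
  square \<open>v v\<^sup>T\<close>, which is what composition with convex functions needs
  (\<open>outer_square_in_cone\<close>), and the identity matrix is an interior point of it, so
  the identity plus any element of the cone is interior too (\<open>identity_plus_cone_interior\<close>). Both
  follow from duality by pairing with positive semidefinite matrices. Pairing with \<open>v v\<^sup>T\<close> is
  evaluation of the form at \<open>v\<close>, and pairing with a symmetric matrix near the identity is
  controlled by an entrywise bound.
\<close>

section \<open>The cone\<close>

lemma trace_symmetrize:
  fixes A B :: "real^'n^'n"
  assumes "B \<in> sym_mats"
  shows "trace ((A + transpose A) ** B) = 2 * (A \<bullet> B)"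
proof -
  have s: "B $ k $ i = B $ i $ k" for i k
    using assms by (metis (mono_tags, lifting) mem_Collect_eq sym_mats_def transpose_def vec_lambda_beta)
  have "trace ((A + transpose A) ** B)
      = (\<Sum>i\<in>UNIV. \<Sum>k\<in>UNIV. A$i$k * B$i$k) + (\<Sum>i\<in>UNIV. \<Sum>k\<in>UNIV. A$k$i * B$k$i)"
    by (simp add: trace_def matrix_matrix_mult_def transpose_def algebra_simps sum.distrib)
       (simp add: s)
  also have "(\<Sum>i\<in>UNIV. \<Sum>k\<in>UNIV. A$k$i * B$k$i) = (\<Sum>i\<in>UNIV. \<Sum>k\<in>UNIV. A$i$k * B$i$k)"
    by (rule sum.swap)
  finally show ?thesis by (simp add: inner_vec_def)
qed

text \<open>
  The bipolar theorem for the cone, in the direction that produces members. A separating hyperplane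
  comes from an arbitrary matrix; only its symmetric part matters against symmetric matrices, and
  this part lies in the polar, hence is positive semidefinite.
\<close>

lemma mem_cone_by_duality:
  fixes P :: "(real^'n^'n) set"
  assumes P: "P \<subseteq> sym_mats" "closed P" "convex_cone P" "positivity_condition P"
    and A: "A \<in> sym_mats" and pos: "\<And>B. B \<in> psd_mats \<Longrightarrow> 0 \<le> trace (B ** A)"
  shows "A \<in> P"
proof (rule ccontr)
  assume "A \<notin> P"
  then obtain a b where ab: "a \<bullet> A < b" "\<And>p. p \<in> P \<Longrightarrow> b < a \<bullet> p"
    using separating_hyperplane_closed_point[of P A] P by (auto simp: convex_cone_def)
  have "b < 0" using ab(2)[of 0] P(3) by (simp add: convex_cone_contains_0)
  have nonneg: "0 \<le> a \<bullet> p" if "p \<in> P" for p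
  proof (rule ccontr)
    assume n: "\<not> 0 \<le> a \<bullet> p"
    have "(b / (a \<bullet> p)) *\<^sub>R p \<in> P"
      using n \<open>b < 0\<close> that P(3) by (intro convex_cone_scaleR) (auto simp: divide_nonpos_nonpos)
    from ab(2)[OF this] n show False by simp
  qed
  have "a + transpose a \<in> polar_cone P"
    unfolding polar_cone_def
  proof safe
    show "a + transpose a \<in> sym_mats"
      by (simp add: sym_mats_def transpose_def vec_eq_iff)
    show "0 \<le> trace ((a + transpose a) ** p)" if "p \<in> P" for p
      using trace_symmetrize[of p a] nonneg[OF that] P(1) that by auto
  qed
  then have "0 \<le> trace ((a + transpose a) ** A)"
    using P(4) pos by (auto simp: positivity_condition_def)
  then show False
    using trace_symmetrize[OF A, of a] ab(1) \<open>b < 0\<close> by simp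
qed

definition outer_square :: "real^'n \<Rightarrow> real^'n^'n" where
  "outer_square v = (\<chi> i j. v $ i * v $ j)"

lemma outer_square_in_cone:
  fixes P :: "(real^'n^'n) set"
  assumes P: "P \<subseteq> sym_mats" "closed P" "convex_cone P" "positivity_condition P"
  shows "outer_square v \<in> P"
proof (rule mem_cone_by_duality[OF P])
  show "outer_square v \<in> sym_mats"
    by (simp add: sym_mats_def outer_square_def transpose_def vec_eq_iff mult.commute)
  fix B :: "real^'n^'n" assume "B \<in> psd_mats"
  moreover have "trace (B ** outer_square v) = v \<bullet> (B *v v)"
    by (simp add: trace_def matrix_matrix_mult_def outer_square_def inner_vec_def
        matrix_vector_mult_def sum_distrib_left mult_ac)
  ultimately show "0 \<le> trace (B ** outer_square v)" by (simp add: psd_mats_def)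
qed

text \<open>Test the form on the vectors \<open>e\<^sub>i + e\<^sub>k\<close> and \<open>e\<^sub>i - e\<^sub>k\<close>.\<close>

lemma psd_entry_bound:
  fixes B :: "real^'n^'n"
  assumes "B \<in> psd_mats"
  shows "2 * \<bar>B $ i $ k\<bar> \<le> B $ i $ i + B $ k $ k"
proof -
  have e: "axis i 1 \<bullet> (B *v axis k 1) = B $ i $ k" for i k
    by (simp add: matrix_vector_mult_basis column_def inner_axis')
  have s: "B $ k $ i = B $ i $ k"
    using assms by (metis (mono_tags, lifting) mem_Collect_eq psd_mats_def sym_mats_def transpose_def vec_lambda_beta)
  have "0 \<le> (axis i 1 + axis k 1) \<bullet> (B *v (axis i 1 + axis k 1))"
       "0 \<le> (axis i 1 - axis k 1) \<bullet> (B *v (axis i 1 - axis k 1))"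
    using assms by (auto simp: psd_mats_def)
  then show ?thesis
    by (simp add: matrix_vector_right_distrib matrix_vector_mult_diff_distrib inner_add_left inner_add_right
        inner_diff_left inner_diff_right e s)
qed

text \<open>
  Let \<open>B\<close> be positive semidefinite and let \<open>\<bar>E\<^sub>k\<^sub>i\<bar> \<le> 1/n\<close> for all entries of \<open>E\<close>. The entry bound
  for \<open>B\<close> gives \<open>\<bar>tr (B E)\<bar> \<le> (1/n) (\<Sum>i k. (B\<^sub>i\<^sub>i + B\<^sub>k\<^sub>k) / 2) = tr B\<close>, which the pairing of
  \<open>B\<close> with the identity exactly compensates. This is where the radius \<open>1/n\<close> comes from.
\<close>

lemma near_identity_in_cone:
  fixes P :: "(real^'n^'n) set"
  assumes P: "P \<subseteq> sym_mats" "closed P" "convex_cone P" "positivity_condition P"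
    and A: "A \<in> sym_mats" and close: "norm (A - mat 1) \<le> 1 / real CARD('n)"
  shows "A \<in> P"
proof (rule mem_cone_by_duality[OF P A])
  fix B :: "real^'n^'n" assume B: "B \<in> psd_mats"
  let ?e = "1 / real CARD('n)"
  have entry: "B$i$k * (if k = i then 1 else 0) - ?e * ((B$i$i + B$k$k) / 2) \<le> B$i$k * A$k$i" for i k
  proof -
    have "\<bar>(A - mat 1)$k$i\<bar> \<le> norm (A - mat 1)"
      using component_le_norm_cart[of "(A - mat 1)$k" i] Finite_Cartesian_Product.norm_nth_le[of "A - mat 1" k] by linarith
    then have "\<bar>A$k$i - (if k = i then 1 else 0)\<bar> \<le> ?e"
      using close by (simp add: mat_def)
    moreover have "\<bar>B$i$k\<bar> \<le> (B$i$i + B$k$k) / 2" using psd_entry_bound[OF B, of i k] by simp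
    ultimately have "\<bar>A$k$i - (if k = i then 1 else 0)\<bar> * \<bar>B$i$k\<bar> \<le> ?e * ((B$i$i + B$k$k) / 2)"
      by (intro mult_mono) auto
    then have "\<bar>B$i$k * (A$k$i - (if k = i then 1 else 0))\<bar> \<le> ?e * ((B$i$i + B$k$k) / 2)"
      by (simp add: abs_mult mult.commute)
    then show ?thesis unfolding right_diff_distrib by linarith
  qed
  have "(\<Sum>i\<in>UNIV. \<Sum>k\<in>UNIV. B$i$k * (if k = i then 1 else 0) - ?e * ((B$i$i + B$k$k) / 2))
      = (\<Sum>i\<in>UNIV. B$i$i) - ?e * ((\<Sum>i\<in>UNIV. \<Sum>k\<in>UNIV. B$i$i + B$k$k) / 2)"
    unfolding sum_subtractf sum_distrib_left[symmetric] sum_divide_distrib[symmetric]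
    by (simp add: if_distrib[of "\<lambda>t. _ * t"] cong: if_cong)
  also have "(\<Sum>i\<in>UNIV. \<Sum>k\<in>UNIV. B$i$i + B$k$k) = 2 * real CARD('n) * (\<Sum>i\<in>UNIV. B$i$i)"
    by (simp add: sum.distrib sum_distrib_left[symmetric])
  finally have "(\<Sum>i\<in>UNIV. \<Sum>k\<in>UNIV. B$i$k * (if k = i then 1 else 0) - ?e * ((B$i$i + B$k$k) / 2)) = 0"
    by simp
  moreover have "(\<Sum>i\<in>UNIV. \<Sum>k\<in>UNIV. B$i$k * (if k = i then 1 else 0) - ?e * ((B$i$i + B$k$k) / 2))
      \<le> (\<Sum>i\<in>UNIV. \<Sum>k\<in>UNIV. B$i$k * A$k$i)"
    by (intro sum_mono entry)
  ultimately show "0 \<le> trace (B ** A)"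
    by (simp add: trace_def matrix_matrix_mult_def)
qed

text \<open>
  A neighbourhood of the identity in the symmetric matrices lies inside \<open>P\<close>, and its translate by
  \<open>B \<in> P\<close> stays there because \<open>P\<close> is closed under addition.
\<close>

lemma identity_plus_cone_interior:
  fixes P :: "(real^'n^'n) set"
  assumes P: "P \<subseteq> sym_mats" "closed P" "convex_cone P" "positivity_condition P"
    and B: "B \<in> P"
  shows "mat 1 + B \<in> (top_of_set sym_mats) interior_of P"
proof -
  let ?T = "sym_mats \<inter> ball (mat 1 + B) (1 / real CARD('n))"
  have "openin (top_of_set sym_mats) ?T" by (simp add: openin_open_Int)
  moreover have "mat 1 + B \<in> ?T"
    using B P(1) by (auto simp: sym_mats_def transpose_def vec_eq_iff mat_def)
  moreover have "?T \<subseteq> P"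
  proof
    fix C assume C: "C \<in> ?T"
    have "C - B \<in> P"
    proof (rule near_identity_in_cone[OF P])
      show "C - B \<in> sym_mats" using C B P(1) by (auto simp: sym_mats_def transpose_def vec_eq_iff)
      have "C - B - mat 1 = - (mat 1 + B - C)" by simp
      then show "norm (C - B - mat 1) \<le> 1 / real CARD('n)"
        using C by (metis IntD2 dist_norm less_imp_le mem_ball norm_minus_cancel)
    qed
    from convex_cone_add[OF P(3) this B] show "C \<in> P" by simp
  qed
  ultimately show ?thesis by (auto simp: interior_of_def)
qed

section \<open>Differential calculus\<close>

lemma partial_deriv_eqI:
  "(u has_derivative D) (at x) \<Longrightarrow> partial_deriv i u x = D (axis i 1)"
  by (simp add: partial_deriv_def frechet_derivative_at[symmetric])

lemma partial_deriv_cong: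
  assumes "open X" "x \<in> X" "\<And>y. y \<in> X \<Longrightarrow> u y = v y" "u differentiable at x"
  shows "partial_deriv i u x = partial_deriv i v x"
  unfolding partial_deriv_def
  using frechet_derivative_transform_within_open[OF assms(4,1,2,3)] by simp

lemma differentiable_cong_open:
  assumes "open X" "x \<in> X" "\<And>y. y \<in> X \<Longrightarrow> u y = v y" "u differentiable at x"
  shows "v differentiable at x"
  using assms has_derivative_transform_within_open unfolding differentiable_def by blast

lemma Ck_on_cong:
  assumes "open X" "\<And>x. x \<in> X \<Longrightarrow> u x = v x" "Ck_on k X u"
  shows "Ck_on k X v"
  using assms(2,3)
proof (induction k arbitrary: u v)
  case 0
  then show ?case by (simp cong: continuous_on_cong)
next
  case (Suc k)
  have "Ck_on k X (partial_deriv i v)" for i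
    by (rule Suc.IH[of "partial_deriv i u"])
       (use Suc.prems partial_deriv_cong[OF assms(1)] in auto)
  moreover have "v differentiable at x" if "x \<in> X" for x
    by (rule differentiable_cong_open[OF assms(1) that, of u]) (use Suc.prems that in auto)
  ultimately show ?case by simp
qed

lemma Ck_on_SucD: "Ck_on (Suc k) X u \<Longrightarrow> Ck_on k X u"
  by (induction k arbitrary: u)
     (auto intro!: continuous_at_imp_continuous_on differentiable_imp_continuous_within)

lemma Ck_on_local:
  assumes "\<And>x. x \<in> X \<Longrightarrow> \<exists>U. open U \<and> x \<in> U \<and> Ck_on k U u"
  shows "Ck_on k X u"
  using assms
proof (induction k arbitrary: u)
  case 0
  then show ?case
    by (metis Ck_on.simps(1) continuous_at_imp_continuous_on continuous_on_eq_continuous_at)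
next
  case (Suc k)
  have "u differentiable at x" if "x \<in> X" for x using Suc.prems[OF that] by auto
  moreover have "Ck_on k X (partial_deriv i u)" for i
    by (rule Suc.IH) (use Suc.prems in fastforce)
  ultimately show ?case by simp
qed

lemma Ck_on_subset: "Ck_on k X u \<Longrightarrow> Y \<subseteq> X \<Longrightarrow> Ck_on k Y u"
  by (induction k arbitrary: u) (auto intro: continuous_on_subset)

lemma partial_deriv_const: "partial_deriv i (\<lambda>x. c) = (\<lambda>x. 0)"
  by (rule ext, rule partial_deriv_eqI[where D = "\<lambda>_. 0"]) simp

lemma Ck_on_const: "Ck_on k X (\<lambda>x. c)"
proof (induction k arbitrary: c)
  case (Suc k)
  then show ?case by (simp add: partial_deriv_const)
qed simp

lemma has_derivative_frechet:
  "u differentiable at x \<Longrightarrow> (u has_derivative frechet_derivative u (at x)) (at x)"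
  using frechet_derivative_works by blast

lemma partial_deriv_add:
  assumes "u differentiable at x" "v differentiable at x"
  shows "partial_deriv i (\<lambda>x. u x + v x) x = partial_deriv i u x + partial_deriv i v x"
  using partial_deriv_eqI[OF has_derivative_add[OF assms[THEN has_derivative_frechet]], of i]
  by (simp add: partial_deriv_def)

lemma partial_deriv_mult:
  assumes "u differentiable at x" "v differentiable at x"
  shows "partial_deriv i (\<lambda>x. u x * v x) x = u x * partial_deriv i v x + partial_deriv i u x * v x"
  using partial_deriv_eqI[OF has_derivative_mult[OF assms[THEN has_derivative_frechet]], of i]
  by (simp add: partial_deriv_def)

lemma partial_deriv_chain:
  fixes f :: "real \<Rightarrow> real"
  assumes "u differentiable at x" "(f has_real_derivative d) (at (u x))"
  shows "partial_deriv i (\<lambda>x. f (u x)) x = d * partial_deriv i u x"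
  using partial_deriv_eqI[OF DERIV_compose_FDERIV[OF assms(2) has_derivative_frechet[OF assms(1)]], of i]
  by (simp add: partial_deriv_def)

lemma Ck_on_add:
  assumes "open X" "Ck_on k X u" "Ck_on k X v"
  shows "Ck_on k X (\<lambda>x. u x + v x)"
  using assms(2,3)
proof (induction k arbitrary: u v)
  case (Suc k)
  have "Ck_on k X (partial_deriv i (\<lambda>x. u x + v x))" for i
    by (rule Ck_on_cong[OF assms(1), of "\<lambda>x. partial_deriv i u x + partial_deriv i v x"])
       (use Suc in \<open>auto simp: partial_deriv_add\<close>)
  then show ?case using Suc.prems by auto
qed (simp add: continuous_on_add)

lemma Ck_on_mult:
  assumes "open X" "Ck_on k X u" "Ck_on k X v"
  shows "Ck_on k X (\<lambda>x. u x * v x)"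
  using assms(2,3)
proof (induction k arbitrary: u v)
  case (Suc k)
  have "Ck_on k X (partial_deriv i (\<lambda>x. u x * v x))" for i
  proof (rule Ck_on_cong[OF assms(1)])
    show "Ck_on k X (\<lambda>x. u x * partial_deriv i v x + partial_deriv i u x * v x)"
      using Suc.prems Suc.prems[THEN Ck_on_SucD] by (intro Ck_on_add[OF assms(1)] Suc.IH) auto
  qed (use Suc.prems in \<open>auto simp: partial_deriv_mult\<close>)
  then show ?case using Suc.prems by auto
qed (simp add: continuous_on_mult)

lemma CinfD: "u \<in> Cinf X \<Longrightarrow> Ck_on k X u"
  by (simp add: Cinf_def)

lemma Cinf_partial_deriv: "u \<in> Cinf X \<Longrightarrow> partial_deriv i u \<in> Cinf X"
proof -
  assume u: "u \<in> Cinf X"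
  have "Ck_on k X (partial_deriv i u)" for k
    using CinfD[OF u, of "Suc k"] by simp
  then show ?thesis by (simp add: Cinf_def)
qed

lemma Cinf_differentiable: "u \<in> Cinf X \<Longrightarrow> x \<in> X \<Longrightarrow> u differentiable at x"
  using CinfD[of u X "Suc 0"] by simp

lemma Cinf_continuous: "u \<in> Cinf X \<Longrightarrow> continuous_on X u"
  using CinfD[of u X 0] by simp

lemma Cinf_const: "(\<lambda>x. c) \<in> Cinf X"
  by (simp add: Cinf_def Ck_on_const)

lemma Cinf_add: "open X \<Longrightarrow> u \<in> Cinf X \<Longrightarrow> v \<in> Cinf X \<Longrightarrow> (\<lambda>x. u x + v x) \<in> Cinf X"
  by (simp add: Cinf_def Ck_on_add)

lemma Cinf_mult: "open X \<Longrightarrow> u \<in> Cinf X \<Longrightarrow> v \<in> Cinf X \<Longrightarrow> (\<lambda>x. u x * v x) \<in> Cinf X"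
  by (simp add: Cinf_def Ck_on_mult)

text \<open>
  Hessians are computed by differentiating a formula for the gradient. The formula is
  needed on all of the open set, since its derivative at \<open>x\<close> depends on a neighbourhood of \<open>x\<close>.
\<close>

lemma hess_eqI:
  assumes "open X" "x \<in> X" and u: "u \<in> Cinf X"
    and grad: "\<And>j y. y \<in> X \<Longrightarrow> partial_deriv j u y = g j y"
    and H: "\<And>i j. partial_deriv i (g j) x = H $ i $ j"
  shows "hess u x = H"
  unfolding hess_def vec_eq_iff
  using partial_deriv_cong[OF assms(1,2) grad Cinf_differentiable[OF Cinf_partial_deriv[OF u] assms(2)]] H
  by auto

section \<open>A smooth convex function that vanishes on the negative half-line\<close>

text \<open>
  The function of interest is \<open>flat 0\<close>, that is \<open>t exp (-1/t)\<close> continued by zero. The factor \<open>t\<close>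
  makes it convex on the whole line, unlike \<open>exp (-1/t)\<close>: its second derivative is
  \<open>exp (-1/t) / t\<^sup>3\<close>. Dividing by powers of \<open>t\<close> yields a family whose span is closed under
  differentiation, so one induction proves the smoothness of all its members.
\<close>

definition flat :: "nat \<Rightarrow> real \<Rightarrow> real" where
  "flat j t = (if t \<le> 0 then 0 else t * exp (- (1 / t)) / t ^ j)"

lemma flat_nonneg: "0 \<le> flat j t"
  by (simp add: flat_def)

lemma flat_pos: "0 < t \<Longrightarrow> 0 < flat j t"
  by (simp add: flat_def)

text \<open>Substituting \<open>s = 1/t\<close>, this is the decay of \<open>s\<^sup>j / exp s\<close> at infinity.\<close>

lemma flat_tendsto_0: "(flat j \<longlongrightarrow> 0) (at 0)"
proof -
  have "((\<lambda>t::real. t * (inverse t ^ j / exp (inverse t))) \<longlongrightarrow> 0 * 0) (at_right 0)"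
    by (intro tendsto_mult filterlim_compose[OF tendsto_power_div_exp_0 filterlim_inverse_at_top_right]
        tendsto_ident_at)
  then have "(flat j \<longlongrightarrow> 0) (at_right 0)"
    by (rule Lim_transform_eventually[OF tendsto_eq_rhs])
       (auto simp: flat_def eventually_at_filter exp_minus field_simps)
  moreover have "(flat j \<longlongrightarrow> 0) (at_left 0)"
    by (rule Lim_transform_eventually[OF tendsto_const])
       (auto simp: flat_def eventually_at_filter)
  ultimately show ?thesis by (simp add: filterlim_at_split)
qed

lemma flat_deriv:
  "(flat j has_real_derivative flat (j + 2) t + (1 - real j) * flat (j + 1) t) (at t)"
proof -
  consider "t < 0" | "t = 0" | "0 < t" by linarith
  then show ?thesis
  proof cases
    case 1
    have "((\<lambda>_. 0) has_real_derivative 0) (at t)" by simp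
    then have "(flat j has_real_derivative 0) (at t)"
      by (rule has_field_derivative_transform_within_open[where S = "{..<0}"])
         (use 1 in \<open>auto simp: flat_def\<close>)
    then show ?thesis using 1 by (simp add: flat_def)
  next
    case 2
    \<comment> \<open>The difference quotient of \<open>flat j\<close> at zero is \<open>flat (j + 1)\<close>.\<close>
    have "((\<lambda>h. (flat j (0 + h) - flat j 0) / h) \<longlongrightarrow> 0) (at 0)"
      by (rule Lim_transform_eventually[OF flat_tendsto_0[of "Suc j"]])
         (auto simp: flat_def eventually_at_filter)
    then show ?thesis using 2 by (simp add: DERIV_def flat_def)
  next
    case 3
    have "((\<lambda>t. t * exp (- (1 / t)) / t ^ j) has_real_derivative
        flat (j + 2) t + (1 - real j) * flat (j + 1) t) (at t)"
      using 3
      apply (auto intro!: derivative_eq_intros simp: flat_def)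
      apply (cases j)
       apply (simp_all add: field_simps power2_eq_square)
      done
    then show ?thesis
      by (rule has_field_derivative_transform_within_open[where S = "{0<..}"])
         (use 3 in \<open>auto simp: flat_def\<close>)
  qed
qed

text \<open>
  The order of differentiability is raised for all \<open>j\<close> simultaneously, since each partial derivative
  of \<open>flat j \<circ> u\<close> involves \<open>flat (j + 1) \<circ> u\<close> and \<open>flat (j + 2) \<circ> u\<close>.
\<close>

lemma Ck_on_flat_compose:
  assumes "open X" "u \<in> Cinf X"
  shows "Ck_on k X (\<lambda>x. flat j (u x))"
proof (induction k arbitrary: j)
  case 0
  have "continuous_on UNIV (flat j)"
    by (intro continuous_at_imp_continuous_on ballI DERIV_isCont[OF flat_deriv])
  then show ?case
    using continuous_on_compose2[OF _ Cinf_continuous[OF assms(2)]] by auto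
next
  case (Suc k)
  have d: "(\<lambda>x. flat j (u x)) differentiable at x" if "x \<in> X" for x
    using DERIV_compose_FDERIV[OF flat_deriv has_derivative_frechet[OF Cinf_differentiable[OF assms(2) that]]]
    unfolding differentiable_def by blast
  have "Ck_on k X (partial_deriv i (\<lambda>x. flat j (u x)))" for i
  proof (rule Ck_on_cong[OF assms(1)])
    show "Ck_on k X (\<lambda>x. (flat (j + 2) (u x) + (1 - real j) * flat (j + 1) (u x)) * partial_deriv i u x)"
      using Cinf_partial_deriv[OF assms(2), of i]
      by (intro Ck_on_mult Ck_on_add Ck_on_const Suc assms(1)) (auto simp: Cinf_def)
  qed (simp add: partial_deriv_chain[OF Cinf_differentiable[OF assms(2)] flat_deriv])
  then show ?case using d by simp
qed

lemma flat_compose_Cinf: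
  "open X \<Longrightarrow> u \<in> Cinf X \<Longrightarrow> (\<lambda>x. flat j (u x)) \<in> Cinf X"
  by (simp add: Cinf_def Ck_on_flat_compose[unfolded Cinf_def])

text \<open>
  The chain rule \<open>Hess (\<phi> \<circ> u) = \<phi>''(u) \<nabla>u \<nabla>u\<^sup>T + \<phi>'(u) Hess u\<close> for \<open>\<phi> = flat 0\<close>, where
  \<open>\<phi>' = flat 2 + flat 1\<close> and \<open>\<phi>'' = flat 4\<close>.
\<close>

lemma hess_flat_compose:
  assumes "open X" "u \<in> Cinf X" "x \<in> X"
  shows "hess (\<lambda>x. flat 0 (u x)) x =
    flat 4 (u x) *\<^sub>R outer_square (\<chi> i. partial_deriv i u x) + (flat 2 (u x) + flat 1 (u x)) *\<^sub>R hess u x"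
proof (rule hess_eqI[OF assms(1,3) flat_compose_Cinf[OF assms(1,2)]])
  fix j y assume "y \<in> X"
  then show "partial_deriv j (\<lambda>x. flat 0 (u x)) y = (flat 2 (u y) + flat 1 (u y)) * partial_deriv j u y"
    using partial_deriv_chain[OF Cinf_differentiable[OF assms(2)] flat_deriv, of y j 0] by (simp add: numeral_2_eq_2)
next
  fix i j
  have d: "((\<lambda>t. flat 2 t + flat 1 t) has_real_derivative flat 4 t) (at t)" for t
    using DERIV_add[OF flat_deriv[of 2 t] flat_deriv[of 1 t]] by (simp add: numeral_eq_Suc)
  have u: "u differentiable at x" "partial_deriv j u differentiable at x"
    by (auto intro: Cinf_differentiable[OF assms(2,3)] Cinf_differentiable[OF Cinf_partial_deriv[OF assms(2)] assms(3)])
  have "(\<lambda>y. flat 2 (u y) + flat 1 (u y)) differentiable at x"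
    using DERIV_compose_FDERIV[OF d has_derivative_frechet[OF u(1)]] unfolding differentiable_def by blast
  from partial_deriv_mult[OF this u(2), of i] partial_deriv_chain[OF u(1) d, of i]
  show "partial_deriv i (\<lambda>y. (flat 2 (u y) + flat 1 (u y)) * partial_deriv j u y) x =
    (flat 4 (u x) *\<^sub>R outer_square (\<chi> i. partial_deriv i u x) + (flat 2 (u x) + flat 1 (u x)) *\<^sub>R hess u x) $ i $ j"
    by (simp add: outer_square_def hess_def algebra_simps)
qed

section \<open>Operations on plurisubharmonic functions\<close>

lemma hess_add:
  assumes "open X" "u \<in> Cinf X" "v \<in> Cinf X" "x \<in> X"
  shows "hess (\<lambda>x. u x + v x) x = hess u x + hess v x"
proof (rule hess_eqI[OF assms(1,4)])
  show "(\<lambda>x. u x + v x) \<in> Cinf X" using assms by (intro Cinf_add)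
  show "partial_deriv j (\<lambda>x. u x + v x) y = partial_deriv j u y + partial_deriv j v y" if "y \<in> X" for j y
    using assms that by (simp add: partial_deriv_add Cinf_differentiable)
  show "partial_deriv i (\<lambda>y. partial_deriv j u y + partial_deriv j v y) x = (hess u x + hess v x) $ i $ j" for i j
    using partial_deriv_add[OF assms(2,3)[THEN Cinf_partial_deriv, THEN Cinf_differentiable[OF _ assms(4)]]]
    by (simp add: hess_def)
qed

lemma hess_cmult:
  assumes "open X" "u \<in> Cinf X" "x \<in> X"
  shows "hess (\<lambda>x. c * u x) x = c *\<^sub>R hess u x"
proof (rule hess_eqI[OF assms(1,3)])
  have m: "partial_deriv i (\<lambda>x. c * v x) y = c * partial_deriv i v y" if "v \<in> Cinf X" "y \<in> X" for v i y
    using partial_deriv_mult[of "\<lambda>_. c" y v i] Cinf_differentiable[OF that] by (simp add: partial_deriv_const)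
  show "(\<lambda>x. c * u x) \<in> Cinf X" using assms by (intro Cinf_mult Cinf_const)
  show "partial_deriv j (\<lambda>x. c * u x) y = c * partial_deriv j u y" if "y \<in> X" for j y
    using m[OF assms(2) that] .
  show "partial_deriv i (\<lambda>y. c * partial_deriv j u y) x = (c *\<^sub>R hess u x) $ i $ j" for i j
    using m[OF Cinf_partial_deriv[OF assms(2)] assms(3)] by (simp add: hess_def)
qed

lemma PSH_continuous: "u \<in> PSH_inf P X \<Longrightarrow> K \<subseteq> X \<Longrightarrow> continuous_on K u"
  using Cinf_continuous continuous_on_subset unfolding PSH_inf_def by fastforce

lemma PSH_const:
  fixes P :: "(real^'n^'n) set"
  assumes "convex_cone P" shows "(\<lambda>x. c) \<in> PSH_inf P X"
proof -
  have "hess (\<lambda>x. c) x = 0" for x :: "real^'n"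
    by (simp add: hess_def partial_deriv_const vec_eq_iff)
  then show ?thesis
    using convex_cone_contains_0[OF assms] by (simp add: PSH_inf_def Cinf_const)
qed

lemma PSH_add:
  assumes "convex_cone P" "open X" "u \<in> PSH_inf P X" "v \<in> PSH_inf P X"
  shows "(\<lambda>x. u x + v x) \<in> PSH_inf P X"
  using assms hess_add[OF assms(2), of u v] convex_cone_add[OF assms(1)]
  by (simp add: PSH_inf_def Cinf_add)

lemma PSH_cmult:
  assumes "convex_cone P" "open X" "u \<in> PSH_inf P X" "0 \<le> c"
  shows "(\<lambda>x. c * u x) \<in> PSH_inf P X"
  using assms hess_cmult[OF assms(2), of u] convex_cone_scaleR[OF assms(1)]
  by (simp add: PSH_inf_def Cinf_mult Cinf_const)

lemma PSH_sum:
  assumes "convex_cone P" "open X" "finite I" "\<And>i. i \<in> I \<Longrightarrow> u i \<in> PSH_inf P X"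
  shows "(\<lambda>x. \<Sum>i\<in>I. u i x) \<in> PSH_inf P X"
  using assms(3,4)
  by (induction I rule: finite_induct) (auto simp: PSH_const[OF assms(1)] PSH_add[OF assms(1,2)])

lemma PSH_flat_compose:
  fixes P :: "(real^'n^'n) set"
  assumes P: "P \<subseteq> sym_mats" "closed P" "convex_cone P" "positivity_condition P"
    and "open X" "u \<in> PSH_inf P X"
  shows "(\<lambda>x. flat 0 (u x)) \<in> PSH_inf P X"
proof -
  have u: "u \<in> Cinf X" "\<And>x. x \<in> X \<Longrightarrow> hess u x \<in> P" using assms(6) by (auto simp: PSH_inf_def)
  have "hess (\<lambda>x. flat 0 (u x)) x \<in> P" if "x \<in> X" for x
    unfolding hess_flat_compose[OF assms(5) u(1) that]
    using flat_nonneg outer_square_in_cone[OF P] u(2)[OF that] P(3)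
    by (intro convex_cone_add convex_cone_scaleR) (auto intro: add_nonneg_nonneg)
  then show ?thesis using flat_compose_Cinf[OF assms(5) u(1)] by (simp add: PSH_inf_def)
qed

lemma half_norm_square:
  fixes X :: "(real^'n) set"
  shows "(\<lambda>x. x \<bullet> x / 2) \<in> Cinf X" "hess (\<lambda>x::real^'n. x \<bullet> x / 2) x = mat 1"
proof -
  have coord: "partial_deriv i (\<lambda>x::real^'n. x $ j) = (\<lambda>x. if i = j then 1 else 0)" for i j
    by (rule ext, subst partial_deriv_eqI[OF bounded_linear.has_derivative[OF bounded_linear_vec_nth has_derivative_ident]])
       (auto simp: axis_def)
  have d: "((\<lambda>x::real^'n. x \<bullet> x / 2) has_derivative (\<lambda>h. x \<bullet> h)) (at x)" for x
    by (auto intro!: derivative_eq_intros simp: inner_commute)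
  have grad: "partial_deriv i (\<lambda>x::real^'n. x \<bullet> x / 2) = (\<lambda>x. x $ i)" for i
    by (rule ext, subst partial_deriv_eqI[OF d]) (simp add: inner_axis)
  have c: "Ck_on k X (\<lambda>x. x $ i)" for k i
  proof (cases k)
    case (Suc l)
    have "(\<lambda>x::real^'n. x $ i) differentiable at x" for x
      by (rule bounded_linear_imp_differentiable[OF bounded_linear_vec_nth])
    then show ?thesis by (simp add: Suc coord Ck_on_const)
  qed (auto intro!: continuous_intros)
  have "Ck_on k X (\<lambda>x. x \<bullet> x / 2)" for k
    by (cases k) (use d c in \<open>auto simp: grad differentiable_def intro!: continuous_intros\<close>)
  then show "(\<lambda>x. x \<bullet> x / 2) \<in> Cinf X" by (simp add: Cinf_def)
  show "hess (\<lambda>x::real^'n. x \<bullet> x / 2) x = mat 1"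
    by (simp add: hess_def grad coord mat_def)
qed

lemma strictly_PSH_add_half_norm_square:
  fixes P :: "(real^'n^'n) set"
  assumes P: "P \<subseteq> sym_mats" "closed P" "convex_cone P" "positivity_condition P"
    and "open X" "u \<in> PSH_inf P X"
  shows "strictly_PSH P X (\<lambda>x. x \<bullet> x / 2 + u x)"
  using assms(6) hess_add[OF assms(5) half_norm_square(1), of u] identity_plus_cone_interior[OF P]
  by (simp add: strictly_PSH_def PSH_inf_def half_norm_square Cinf_add assms(5))

lemma strictly_PSH_local:
  assumes "\<And>x. x \<in> X \<Longrightarrow> \<exists>U v. open U \<and> x \<in> U \<and> (\<forall>y\<in>U. u y = v y) \<and> strictly_PSH P U v"
  shows "strictly_PSH P X u"
  unfolding strictly_PSH_def
proof
  show "u \<in> Cinf X"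
    unfolding Cinf_def
  proof (intro CollectI allI Ck_on_local)
    fix k x assume "x \<in> X"
    then obtain U v where "open U" "x \<in> U" "\<forall>y\<in>U. u y = v y" "strictly_PSH P U v" using assms by blast
    then show "\<exists>U. open U \<and> x \<in> U \<and> Ck_on k U u"
      using Ck_on_cong[of U v u k] by (auto simp: strictly_PSH_def Cinf_def)
  qed
  show "\<forall>x\<in>X. hess u x \<in> (top_of_set sym_mats) interior_of P"
  proof
    fix x assume "x \<in> X"
    then obtain U v where U: "open U" "x \<in> U" "\<forall>y\<in>U. u y = v y" "strictly_PSH P U v" using assms by blast
    then have v: "v \<in> Cinf U" by (simp add: strictly_PSH_def)
    then have uC: "u \<in> Cinf U" using Ck_on_cong[of U v u] U by (auto simp: Cinf_def)
    have "hess u x = hess v x"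
    proof (rule hess_eqI[OF U(1,2) uC])
      show "partial_deriv j u y = partial_deriv j v y" if "y \<in> U" for j y
        by (rule partial_deriv_cong[OF U(1) that]) (use U(3) Cinf_differentiable[OF uC that] in auto)
    qed (simp add: hess_def)
    then show "hess u x \<in> (top_of_set sym_mats) interior_of P"
      using U by (simp add: strictly_PSH_def)
  qed
qed

section \<open>Hulls and exhaustions\<close>

text \<open>
  The hull lies in the sublevel set at the maximum of \<open>u\<close> over \<open>K\<close>. For empty \<open>K\<close> there is no
  maximum, but the supremum \<open>-\<infinity>\<close> makes the hull empty.
\<close>

lemma hull_relatively_compact:
  assumes u: "u \<in> PSH_inf P X" and proper: "proper_exhaustion X u" and K: "compact K" "K \<subseteq> X"
  shows "relatively_compact_in (psh_hull P X K) X"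
proof (cases "K = {}")
  case True
  then have "psh_hull P X K = {}" using u by (auto simp: psh_hull_def bot_ereal_def)
  then show ?thesis by (simp add: relatively_compact_in_def)
next
  case False
  have "continuous_on K u"
    by (rule PSH_continuous[OF u K(2)])
  then obtain z where z: "z \<in> K" "\<forall>y\<in>K. u y \<le> u z"
    using continuous_attains_sup[OF K(1) False] by blast
  have sub: "psh_hull P X K \<subseteq> {x \<in> X. u x \<le> u z}"
  proof
    fix x assume "x \<in> psh_hull P X K"
    then have "x \<in> X" "ereal (u x) \<le> (SUP y\<in>K. ereal (u y))" using u by (auto simp: psh_hull_def)
    moreover have "(SUP y\<in>K. ereal (u y)) \<le> ereal (u z)" using z by (auto intro: SUP_least)
    ultimately show "x \<in> {x \<in> X. u x \<le> u z}" by (metis (mono_tags, lifting) ereal_less_eq(3) mem_Collect_eq order_trans)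
  qed
  have c: "compact {x \<in> X. u x \<le> u z}" using proper by (simp add: proper_exhaustion_def)
  have "closure (psh_hull P X K) \<subseteq> {x \<in> X. u x \<le> u z}"
    by (rule closure_minimal[OF sub compact_imp_closed[OF c]])
  then show ?thesis
    unfolding relatively_compact_in_def
    using compact_closure bounded_subset[OF compact_imp_bounded[OF c] sub] by auto
qed

text \<open>
  A function that witnesses \<open>x \<notin> psh_hull P X K\<close> exceeds at \<open>x\<close> some constant that bounds it
  on \<open>K\<close>; subtract this constant and compose with \<open>flat 0\<close>.
\<close>

lemma PSH_peak:
  fixes P :: "(real^'n^'n) set"
  assumes P: "P \<subseteq> sym_mats" "closed P" "convex_cone P" "positivity_condition P"
    and "open X" "x \<in> X" "x \<notin> psh_hull P X K"
  shows "\<exists>w\<in>PSH_inf P X. (\<forall>y. 0 \<le> w y) \<and> (\<forall>y\<in>K. w y = 0) \<and> 0 < w x"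
proof -
  obtain u where u: "u \<in> PSH_inf P X" "(SUP y\<in>K. ereal (u y)) < ereal (u x)"
    using assms(6,7) by (auto simp: psh_hull_def not_le)
  obtain c where c: "(SUP y\<in>K. ereal (u y)) < ereal c" "ereal c < ereal (u x)"
    using ereal_dense2[OF u(2)] by blast
  have below: "u y \<le> c" if "y \<in> K" for y
    using SUP_upper[OF that, of "\<lambda>y. ereal (u y)"] c(1)
    by (metis ereal_less_eq(3) less_imp_le order_trans)
  have "(\<lambda>y. flat 0 (u y + - c)) \<in> PSH_inf P X"
    by (intro PSH_flat_compose[OF P] PSH_add[OF P(3)] u(1) PSH_const[OF P(3)] assms(5))
  moreover have "\<forall>y\<in>K. flat 0 (u y + - c) = 0" using below by (simp add: flat_def)
  moreover have "0 < flat 0 (u x + - c)" using c(2) by (intro flat_pos) simp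
  ultimately show ?thesis using flat_nonneg by (intro bexI[of _ "\<lambda>y. flat 0 (u y + - c)"]) auto
qed

text \<open>
  The positivity sets of the functions from \<open>PSH_peak\<close> cover \<open>L\<close>. The sum over a finite subcover
  has a positive minimum on \<open>L\<close>, and scaling raises it to any given height \<open>M\<close>.
\<close>

lemma PSH_large_on_compact:
  fixes P :: "(real^'n^'n) set"
  assumes P: "P \<subseteq> sym_mats" "closed P" "convex_cone P" "positivity_condition P"
    and "open X" "compact L" "L \<subseteq> X" "L \<inter> psh_hull P X K = {}"
  shows "\<exists>v\<in>PSH_inf P X. (\<forall>y. 0 \<le> v y) \<and> (\<forall>y\<in>K. v y = 0) \<and> (\<forall>y\<in>L. M \<le> v y)"
proof -
  have "\<exists>w. \<forall>x\<in>L. w x \<in> PSH_inf P X \<and> (\<forall>y. 0 \<le> w x y) \<and> (\<forall>y\<in>K. w x y = 0) \<and> 0 < w x x"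
    by (rule bchoice) (use PSH_peak[OF P assms(5)] assms(7,8) in blast)
  then obtain w where w: "\<And>x. x \<in> L \<Longrightarrow> w x \<in> PSH_inf P X" "\<And>x y. x \<in> L \<Longrightarrow> 0 \<le> w x y"
    "\<And>x y. x \<in> L \<Longrightarrow> y \<in> K \<Longrightarrow> w x y = 0" "\<And>x. x \<in> L \<Longrightarrow> 0 < w x x" by metis
  have cont: "continuous_on X (w x)" if "x \<in> L" for x
    by (rule PSH_continuous[OF w(1)[OF that] order_refl])
  have "open (X \<inter> w x -` {0<..})" if "x \<in> L" for x
    by (rule continuous_open_preimage[OF cont[OF that] assms(5)]) simp
  moreover have "L \<subseteq> (\<Union>x\<in>L. X \<inter> w x -` {0<..})" using w(4) assms(7) by auto
  ultimately obtain F where F: "F \<subseteq> L" "finite F" "L \<subseteq> (\<Union>x\<in>F. X \<inter> w x -` {0<..})"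
    using compactE_image[OF assms(6), of L "\<lambda>x. X \<inter> w x -` {0<..}"] by metis
  define s where "s y = (\<Sum>x\<in>F. w x y)" for y
  have s: "s \<in> PSH_inf P X"
    unfolding s_def by (rule PSH_sum[OF P(3) assms(5) F(2)]) (use w F in auto)
  have s0: "0 \<le> s y" for y unfolding s_def using w(2) F(1) by (intro sum_nonneg) blast
  have sK: "s y = 0" if "y \<in> K" for y unfolding s_def using w(3) F(1) that by (intro sum.neutral) blast
  have spos: "0 < s y" if y: "y \<in> L" for y
  proof -
    obtain x where "x \<in> F" "0 < w x y" using F(3) y by auto
    then show ?thesis unfolding s_def using F w(2) by (intro sum_pos2[of F x]) auto
  qed
  have "\<exists>d>0. \<forall>y\<in>L. d \<le> s y"
  proof (cases "L = {}")
    case False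
    have "continuous_on L s"
      by (rule PSH_continuous[OF s assms(7)])
    then obtain z where "z \<in> L" "\<forall>y\<in>L. s z \<le> s y" using continuous_attains_inf[OF assms(6) False] by blast
    then show ?thesis using spos by auto
  qed (auto intro: zero_less_one)
  then obtain d where d: "d > 0" "\<And>y. y \<in> L \<Longrightarrow> d \<le> s y" by blast
  have "M \<le> \<bar>M\<bar> / d * s y" if "y \<in> L" for y
  proof -
    have "\<bar>M\<bar> / d * d \<le> \<bar>M\<bar> / d * s y" using d that by (intro mult_left_mono) auto
    then show ?thesis using d(1) by auto
  qed
  then show ?thesis
    using PSH_cmult[OF P(3) assms(5) s, of "\<bar>M\<bar> / d"] s0 sK d(1)
    by (intro bexI[of _ "\<lambda>y. \<bar>M\<bar> / d * s y"]) auto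
qed

text \<open>
  Pass to a subsequence of an arbitrary compact exhaustion: the closure of each hull is compact
  in \<open>X\<close> and so is eventually swallowed by the exhaustion.
\<close>

lemma exhaustion_by_hulls:
  fixes X :: "(real^'n) set"
  assumes "open X" and hull: "\<And>K. compact K \<Longrightarrow> K \<subseteq> X \<Longrightarrow> relatively_compact_in (psh_hull P X K) X"
  obtains K where "\<And>m. compact (K m)" "\<And>m. K m \<subseteq> X" "\<And>m. K m \<subseteq> interior (K (Suc m))"
    "\<And>m. psh_hull P X (K m) \<subseteq> interior (K (Suc m))" "X \<subseteq> (\<Union>m. K m)"
proof -
  obtain C where C: "\<And>n. compact (C n)" "\<And>n. C n \<subseteq> X" "\<And>n. C n \<subseteq> interior (C (Suc n))"
    "\<Union>(range C) = X" "\<And>K. compact K \<Longrightarrow> K \<subseteq> X \<Longrightarrow> \<exists>N. \<forall>n\<ge>N. K \<subseteq> C n"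
    by (rule open_Union_compact_subsets[OF assms(1)]) blast
  have "\<exists>r. \<forall>m. m \<le> r m \<and> (C (r m) \<subseteq> interior (C (r (Suc m))) \<and> psh_hull P X (C (r m)) \<subseteq> interior (C (r (Suc m))))"
  proof (rule dependent_nat_choice)
    fix k m :: nat assume "m \<le> k"
    have h: "relatively_compact_in (psh_hull P X (C k)) X" using hull C(1,2) .
    obtain N1 where N1: "\<forall>n\<ge>N1. closure (psh_hull P X (C k)) \<subseteq> C n"
      using C(5)[of "closure (psh_hull P X (C k))"] h unfolding relatively_compact_in_def by blast
    obtain N2 where N2: "\<forall>n\<ge>N2. C k \<subseteq> C n" using C(5)[OF C(1,2)] by blast
    let ?n = "Suc (max m (max N1 N2))"
    have "C k \<subseteq> interior (C ?n)" "psh_hull P X (C k) \<subseteq> interior (C ?n)"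
      using N1 N2 C(3)[of "max m (max N1 N2)"] closure_subset[of "psh_hull P X (C k)"]
      by (meson max.cobounded1 max.cobounded2 order_trans)+
    then show "\<exists>n. Suc m \<le> n \<and> C k \<subseteq> interior (C n) \<and> psh_hull P X (C k) \<subseteq> interior (C n)"
      by (intro exI[of _ ?n]) auto
  qed auto
  then obtain r where r: "\<And>m. m \<le> r m" "\<And>m. C (r m) \<subseteq> interior (C (r (Suc m)))"
    "\<And>m. psh_hull P X (C (r m)) \<subseteq> interior (C (r (Suc m)))" by blast
  have "C n \<subseteq> C (r n)" for n
    using lift_Suc_mono_le[of C n "r n"] C(3) interior_subset r(1) by (metis order_trans)
  then have "X \<subseteq> (\<Union>m. C (r m))" using C(4) by blast
  with r C(1,2) show thesis by (intro that[of "\<lambda>m. C (r m)"]) auto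
qed

lemma strictly_PSH_exhaustion:
  fixes P :: "(real^'n^'n) set" and X :: "(real^'n) set"
  assumes P: "P \<subseteq> sym_mats" "closed P" "convex_cone P" "positivity_condition P"
    and X: "open X" and hull: "\<And>K. compact K \<Longrightarrow> K \<subseteq> X \<Longrightarrow> relatively_compact_in (psh_hull P X K) X"
  shows "\<exists>u. proper_exhaustion X u \<and> strictly_PSH P X u"
proof -
  obtain K where K: "\<And>m. compact (K m)" "\<And>m. K m \<subseteq> X" "\<And>m. K m \<subseteq> interior (K (Suc m))"
    "\<And>m. psh_hull P X (K m) \<subseteq> interior (K (Suc m))" "X \<subseteq> (\<Union>m. K m)"
    using exhaustion_by_hulls[OF X hull] by blast
  have mono: "K m \<subseteq> K n" if "m \<le> n" for m n
    using lift_Suc_mono_le[of K m n] K(3) interior_subset that by (metis order_trans)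
  define L where "L m = K (m + 2) - interior (K (m + 1))" for m
  have "\<exists>v. v \<in> PSH_inf P X \<and> (\<forall>y. 0 \<le> v y) \<and> (\<forall>y\<in>K m. v y = 0) \<and> (\<forall>y\<in>L m. real m \<le> v y)" for m
    using PSH_large_on_compact[OF P X, of "L m" "K m" "real m"] K(1,2)[of "m + 2"] K(4)[of m]
    unfolding L_def by (auto intro: compact_diff)
  then obtain v where v: "\<And>m. v m \<in> PSH_inf P X" "\<And>m y. 0 \<le> v m y" "\<And>m y. y \<in> K m \<Longrightarrow> v m y = 0"
    "\<And>m y. y \<in> L m \<Longrightarrow> real m \<le> v m y" by metis
  \<comment> \<open>On \<open>K M\<close> all terms of the series with index at least \<open>M\<close> vanish.\<close>
  define u where "u x = x \<bullet> x / 2 + (\<Sum>m. v m x)" for x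
  have u_eq: "u x = x \<bullet> x / 2 + (\<Sum>m<M. v m x)" if "x \<in> K M" for x M
    unfolding u_def
    by (subst suminf_finite[of "{..<M}"]) (use that v(3) mono in \<open>auto simp: not_less subset_iff\<close>)
  have strict: "strictly_PSH P X u"
  proof (rule strictly_PSH_local)
    fix x assume "x \<in> X"
    then obtain m where "x \<in> K m" using K(5) by blast
    then have x: "x \<in> interior (K (Suc m))" using K(3) by blast
    let ?U = "interior (K (Suc m))"
    have "?U \<subseteq> X" using K(2) interior_subset by blast
    have "(\<lambda>x. \<Sum>m<Suc m. v m x) \<in> PSH_inf P ?U"
      by (rule PSH_sum[OF P(3)])
         (use v(1) \<open>?U \<subseteq> X\<close> in \<open>auto simp: PSH_inf_def Cinf_def intro: Ck_on_subset\<close>)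
    from strictly_PSH_add_half_norm_square[OF P open_interior this]
    show "\<exists>U w. open U \<and> x \<in> U \<and> (\<forall>y\<in>U. u y = w y) \<and> strictly_PSH P U w"
      using x u_eq interior_subset[of "K (Suc m)"]
      by (intro exI[of _ ?U] exI[of _ "\<lambda>x. x \<bullet> x / 2 + (\<Sum>m<Suc m. v m x)"]) blast
  qed
  have large: "real M \<le> u x" if x: "x \<in> X" "x \<notin> K (Suc M)" for x M
  proof -
    \<comment> \<open>If \<open>p\<close> is the first index with \<open>x \<in> K p\<close>, then \<open>x\<close> lies in the shell \<open>L (p - 2)\<close>.\<close>
    define p where "p = (LEAST p. x \<in> K p)"
    have xp: "x \<in> K p" unfolding p_def using K(5) x by (auto intro: LeastI)
    have "Suc M < p" using xp mono[of p "Suc M"] x(2) by (meson not_le subsetD)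
    then obtain m where m: "p = m + 2" "M \<le> m" by (metis Suc_le_eq add_2_eq_Suc' less_imp_Suc_add le_add1 add_Suc add.commute add_Suc_right)
    have "x \<notin> K (m + 1)" using not_less_Least[of "m + 1" "\<lambda>p. x \<in> K p"] m(1) unfolding p_def by simp
    then have "x \<in> L m" using xp m interior_subset unfolding L_def by blast
    then have "real M \<le> v m x" using v(4) m(2) by fastforce
    also have "\<dots> \<le> (\<Sum>m<p. v m x)" using m(1) v(2) by (intro member_le_sum) auto
    also have "\<dots> \<le> u x" using u_eq[OF xp] by simp
    finally show ?thesis .
  qed
  have "compact {x \<in> X. u x \<le> c}" for c
  proof -
    obtain M where M: "c < real M" using reals_Archimedean2 by blast
    have eq: "{x \<in> X. u x \<le> c} = {x \<in> K (Suc M). u x \<le> c}"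
      using large[of _ M] M K(2) by fastforce
    have "continuous_on (K (Suc M)) u"
      using strict K(2) Cinf_continuous continuous_on_subset unfolding strictly_PSH_def by blast
    then have "closed {x \<in> K (Suc M). u x \<le> c}"
      using K(1) by (intro continuous_on_closed_Collect_le) (auto intro: compact_imp_closed)
    then have "compact (K (Suc M) \<inter> {x \<in> K (Suc M). u x \<le> c})" by (rule compact_Int_closed[OF K(1)])
    then show ?thesis unfolding eq by (simp add: Int_def conj_ac)
  qed
  with strict show ?thesis by (auto simp: proper_exhaustion_def)
qed

theorem proposition9p3:
  fixes P :: "(real^'n^'n) set" and X :: "(real^'n) set"
  assumes "P \<subseteq> sym_mats" and "closed P" and "convex_cone P"
    and "positivity_condition P"
    and "open X" and "connected X"
  shows "(\<forall>K. compact K \<and> K \<subseteq> X \<longrightarrow> relatively_compact_in (psh_hull P X K) X) \<longleftrightarrow>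
    (\<exists>u\<in>Cinf X. proper_exhaustion X u \<and> strictly_PSH P X u)"
proof
  assume "\<forall>K. compact K \<and> K \<subseteq> X \<longrightarrow> relatively_compact_in (psh_hull P X K) X"
  then show "\<exists>u\<in>Cinf X. proper_exhaustion X u \<and> strictly_PSH P X u"
    using strictly_PSH_exhaustion[OF assms(1-5)] unfolding strictly_PSH_def by blast
next
  assume "\<exists>u\<in>Cinf X. proper_exhaustion X u \<and> strictly_PSH P X u"
  then obtain u where u: "proper_exhaustion X u" "strictly_PSH P X u" by blast
  have "u \<in> PSH_inf P X"
    using u(2) interior_of_subset[of "top_of_set sym_mats" P] unfolding strictly_PSH_def PSH_inf_def by blast
  then show "\<forall>K. compact K \<and> K \<subseteq> X \<longrightarrow> relatively_compact_in (psh_hull P X K) X"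
    using hull_relatively_compact[OF _ u(1)] by blast
qed

end
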